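(* Every $12$-cap of dimension $7$ in $\mathbb{Z}_2^n$ has a basis of type $5\text{-}5\text{-}5\text{-}5$.
   Context: Work in $\mathbb{Z}_2^n$. An affine combination of a set is a sum of an odd number of its distinct elements; $\operatorname{aff}(S)$ is the set of all affine combinations of elements of $S$, and the dimension of $S$ is the dimension of the affine flat $\operatorname{aff}(S)$. A basis for $S$ is a subset $B\subseteq S$ that is affinely independent (no element is an affine combination of the others) with $\operatorname{aff}(B)=\operatorname{aff}(S)$; its dependent set is $D=S\setminus B$. For $x\in D$, $B_x$ is the unique subset of $B$ whose elements sum to $x$. A quad is a set of four distinct elements summing to $\mathbf{0}$; a cap is a quad-free subset; a $k$-cap is a cap with $k$ elements. The type of $B$ is the list of the numbers $|B_x|$, $x\in D$, in nonincreasing order, separated by hyphens. *)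

theory Defs
  imports "HOL-Analysis.Analysis" "HOL-Library.Z2" "HOL-Library.Multiset"
begin

text \<open>
  The space \<open>\<int>\<^sub>2\<^sup>n\<close> is rendered as the type \<^typ>\<open>bit ^ 'n\<close>.  It is finite, so all its subsets are.
\<close>

definition aff :: "(bit ^ 'n) set \<Rightarrow> (bit ^ 'n) set" where
  "aff S = {\<Sum>A | A. A \<subseteq> S \<and> finite A \<and> odd (card A)}"

text \<open>
  The dimension of a flat \<open>F\<close> is the linear dimension of its direction space \<open>{x - y | x y \<in> F}\<close>.
  The empty set gets dimension 0 here.
\<close>

definition flat_dim :: "(bit ^ 'n) set \<Rightarrow> nat" where
  "flat_dim F = vec.dim {x - y | x y. x \<in> F \<and> y \<in> F}"

definition aff_dimension :: "(bit ^ 'n) set \<Rightarrow> nat" where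
  "aff_dimension S = flat_dim (aff S)"

definition aff_independent :: "(bit ^ 'n) set \<Rightarrow> bool" where
  "aff_independent B \<longleftrightarrow> (\<forall>x\<in>B. x \<notin> aff (B - {x}))"

definition aff_basis :: "(bit ^ 'n) set \<Rightarrow> (bit ^ 'n) set \<Rightarrow> bool" where
  "aff_basis S B \<longleftrightarrow> B \<subseteq> S \<and> aff_independent B \<and> aff B = aff S"

text \<open>
  The subset \<open>B\<^sub>x\<close> of a basis \<open>B\<close>: uniqueness holds among the subsets of odd cardinality (affine
  combinations).  Without the parity condition it fails if \<open>0 \<in> aff B\<close>.
\<close>

definition basis_part :: "(bit ^ 'n) set \<Rightarrow> bit ^ 'n \<Rightarrow> (bit ^ 'n) set" where
  "basis_part B x = (THE A. A \<subseteq> B \<and> finite A \<and> odd (card A) \<and> \<Sum>A = x)"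

definition quad :: "(bit ^ 'n) set \<Rightarrow> bool" where
  "quad Q \<longleftrightarrow> card Q = 4 \<and> \<Sum>Q = 0"

definition cap :: "(bit ^ 'n) set \<Rightarrow> bool" where
  "cap C \<longleftrightarrow> (\<forall>Q. Q \<subseteq> C \<longrightarrow> \<not> quad Q)"

definition k_cap :: "nat \<Rightarrow> (bit ^ 'n) set \<Rightarrow> bool" where
  "k_cap k C \<longleftrightarrow> cap C \<and> card C = k"

definition basis_type :: "(bit ^ 'n) set \<Rightarrow> (bit ^ 'n) set \<Rightarrow> nat list" where
  "basis_type S B =
     rev (sorted_list_of_multiset
       (image_mset (\<lambda>x. card (basis_part B x)) (mset_set (S - B))))"

end

theory Submission
  imports Defs
begin

text \<open>
  The even subsets of the cap with sum \<open>0\<close> form a binary code \<open>K\<close> of length 12 and dimension 4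
  whose nonempty words have even size at least 6.  Double counting forces the following: for every
  point \<open>c\<close>, exactly one word avoiding \<open>c\<close> has size 8, and all other nonempty words avoiding \<open>c\<close>
  have size 6.  Let \<open>F\<close> be the word of size 8 avoiding \<open>b\<^sub>1\<close>, let \<open>b\<^sub>2\<close> be another point outside \<open>F\<close>,
  take \<open>b\<^sub>3 \<in> F\<close>, let \<open>F'\<close> be the word of size 8 avoiding \<open>b\<^sub>3\<close>, and let \<open>G\<close> be the unique nonempty
  word avoiding \<open>b\<^sub>1, b\<^sub>2, b\<^sub>3\<close>.  Since \<open>|G| = 6\<close>, \<open>G \<subseteq> F'\<close> would make \<open>F' - G\<close> a word of size 2, so
  there is \<open>b\<^sub>4 \<in> G - F'\<close>.  Then \<open>D = {b\<^sub>1, b\<^sub>2, b\<^sub>3, b\<^sub>4}\<close> is an information set of the code, and the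
  word meeting \<open>D\<close> in a single point is neither \<open>F\<close> nor \<open>F'\<close>, so it has size 6.  Hence the complement
  of \<open>D\<close> is a basis of type 5-5-5-5.
\<close>

section \<open>Counting in binary linear codes\<close>

text \<open>A word is represented by its support, so addition over the two-element field becomes
  symmetric difference. The empty family also qualifies, hence the explicit members in later
  lemmas.\<close>

definition sym_diff_closed :: "'a set set \<Rightarrow> bool" where
  "sym_diff_closed K \<longleftrightarrow> (\<forall>A\<in>K. \<forall>B\<in>K. sym_diff A B \<in> K)"

lemma sym_diff_closedD: "sym_diff_closed K \<Longrightarrow> A \<in> K \<Longrightarrow> B \<in> K \<Longrightarrow> sym_diff A B \<in> K"
  by (simp add: sym_diff_closed_def)

lemma empty_in_sym_diff_closed: "sym_diff_closed K \<Longrightarrow> A \<in> K \<Longrightarrow> {} \<in> K"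
  using sym_diff_closedD[of K A A] by simp

lemma sym_diff_closed_avoiding: "sym_diff_closed K \<Longrightarrow> sym_diff_closed {A \<in> K. c \<notin> A}"
  by (auto simp: sym_diff_closed_def)

text \<open>Translation by a fixed element of a fibre maps that fibre bijectively onto the kernel,
  so all fibres over the image have equal size. Only image values must be their own negatives, and
  additivity forces this.\<close>

lemma card_image_mult_card_kernel:
  fixes h :: "'a set \<Rightarrow> 'b::ab_group_add"
  assumes fin: "finite K" and cl: "sym_diff_closed K"
    and add: "\<And>A B. A \<in> K \<Longrightarrow> B \<in> K \<Longrightarrow> h (sym_diff A B) = h A + h B"
  shows "card K = card (h ` K) * card {A \<in> K. h A = 0}"
proof -
  have h0: "h {} = 0" if "A \<in> K" for A
  proof -
    have "{} \<in> K" using empty_in_sym_diff_closed[OF cl that] .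
    then have "h {} = h {} + h {}" using add[of "{}" "{}"] by simp
    then show ?thesis by simp
  qed
  have self: "h A + h A = 0" if "A \<in> K" for A
    using add[OF that that] h0[OF that] by simp
  have fibre: "card {A \<in> K. h A = v} = card {A \<in> K. h A = 0}" if v: "v \<in> h ` K" for v
  proof -
    obtain A0 where A0: "A0 \<in> K" "h A0 = v" using v by blast
    have inv: "sym_diff (sym_diff A A0) A0 = A" for A by blast
    have "bij_betw (\<lambda>A. sym_diff A A0) {A \<in> K. h A = v} {A \<in> K. h A = 0}"
    proof (rule bij_betw_byWitness[where f' = "\<lambda>A. sym_diff A A0"])
      show "(\<lambda>A. sym_diff A A0) ` {A \<in> K. h A = v} \<subseteq> {A \<in> K. h A = 0}"
        using A0 add self sym_diff_closedD[OF cl] by auto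
      show "(\<lambda>A. sym_diff A A0) ` {A \<in> K. h A = 0} \<subseteq> {A \<in> K. h A = v}"
        using A0 add sym_diff_closedD[OF cl] by auto
    qed (simp_all add: inv)
    then show ?thesis by (rule bij_betw_same_card)
  qed
  have "card K = (\<Sum>v\<in>h ` K. card {A \<in> K. h A = v})"
    using sum.image_gen[OF fin, of "\<lambda>_. 1::nat" h] by simp
  also have "\<dots> = (\<Sum>v\<in>h ` K. card {A \<in> K. h A = 0})"
    by (rule sum.cong) (simp_all add: fibre)
  finally show ?thesis by simp
qed

text \<open>Membership of \<open>c\<close>, read as a bit, is additive and takes both values because
  of \<open>{}\<close> and \<open>A\<close>; the words avoiding \<open>c\<close> are its
  kernel.\<close>

lemma card_avoiding:
  assumes fin: "finite K" and cl: "sym_diff_closed K" and A: "A \<in> K" "c \<in> A"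
  shows "card K = 2 * card {A \<in> K. c \<notin> A}"
proof -
  have im: "(\<lambda>A. of_bool (c \<in> A) :: bit) ` K = {0, 1}"
  proof
    have "0 = (of_bool (c \<in> {}) :: bit)" by simp
    moreover have "1 = (of_bool (c \<in> A) :: bit)" using A by simp
    ultimately show "{0, 1} \<subseteq> (\<lambda>A. of_bool (c \<in> A) :: bit) ` K"
      using empty_in_sym_diff_closed[OF cl A(1)] A(1) by blast
  qed auto
  have "card K = card ((\<lambda>A. of_bool (c \<in> A) :: bit) ` K) * card {A \<in> K. (of_bool (c \<in> A) :: bit) = 0}"
    by (rule card_image_mult_card_kernel[OF fin cl]) auto
  then show ?thesis unfolding im by simp
qed

lemma card_containing:
  assumes fin: "finite K" and cl: "sym_diff_closed K"
  shows "card {A \<in> K. c \<in> A} = 0 \<or> 2 * card {A \<in> K. c \<in> A} = card K"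
proof (cases "\<exists>A\<in>K. c \<in> A")
  case True
  then have "card K = 2 * card {A \<in> K. c \<notin> A}" using card_avoiding[OF fin cl] by blast
  moreover have "card K = card {A \<in> K. c \<in> A} + card {A \<in> K. c \<notin> A}"
    using fin by (subst card_Un_disjoint[symmetric]) (auto intro: arg_cong[where f = card])
  ultimately show ?thesis by simp
next
  case False
  then have "{A \<in> K. c \<in> A} = {}" by blast
  then show ?thesis by (metis card.empty)
qed

lemma sum_card_eq_sum_containing:
  assumes "finite C" "finite K" "K \<subseteq> Pow C"
  shows "(\<Sum>A\<in>K. card A) = (\<Sum>c\<in>C. card {A \<in> K. c \<in> A})"
proof -
  have "(\<Sum>A\<in>K. card A) = (\<Sum>A\<in>K. \<Sum>c\<in>C. if c \<in> A then 1 else 0)"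
  proof (rule sum.cong)
    fix A assume "A \<in> K"
    then have "C \<inter> A = A" using assms by blast
    then show "card A = (\<Sum>c\<in>C. if c \<in> A then 1 else 0)"
      using assms(1) by (simp add: sum.inter_restrict[symmetric])
  qed simp
  also have "\<dots> = (\<Sum>c\<in>C. \<Sum>A\<in>K. if c \<in> A then 1 else 0)" by (rule sum.swap)
  also have "\<dots> = (\<Sum>c\<in>C. card {A \<in> K. c \<in> A})"
    using assms(2) by (simp add: sum.inter_filter[symmetric])
  finally show ?thesis .
qed

text \<open>If no word contained \<open>c\<close>, the remaining points, each in at most
  \<open>k\<close> words, would bound the total weight by \<open>k * (card C - 1)\<close>, while the
  minimum weight makes it at least \<open>w * (card K - 1)\<close>.\<close>

lemma all_containing_nonzero:
  assumes fC: "finite C" and fK: "finite K" and K: "K \<subseteq> Pow C" and cl: "sym_diff_closed K"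
    and k: "card K = 2 * k" and wt: "\<And>A. A \<in> K \<Longrightarrow> A \<noteq> {} \<Longrightarrow> w \<le> card A"
    and big: "k * (card C - 1) < w * (card K - 1)" and c: "c \<in> C"
  shows "card {A \<in> K. c \<in> A} = k"
proof (rule ccontr)
  have le: "card {A \<in> K. x \<in> A} \<le> k" for x
    using card_containing[OF fK cl, of x] k by auto
  assume "card {A \<in> K. c \<in> A} \<noteq> k"
  then have "card {A \<in> K. c \<in> A} = 0" using card_containing[OF fK cl, of c] k by auto
  then have "(\<Sum>x\<in>C. card {A \<in> K. x \<in> A}) = (\<Sum>x\<in>C - {c}. card {A \<in> K. x \<in> A})"
    using fC c by (simp add: sum.remove)
  also have "\<dots> \<le> (\<Sum>x\<in>C - {c}. k)" by (rule sum_mono) (rule le)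
  also have "\<dots> = k * (card C - 1)" using fC c by simp
  finally have up: "(\<Sum>A\<in>K. card A) \<le> k * (card C - 1)"
    using sum_card_eq_sum_containing[OF fC fK K] by simp
  have "w * (card K - 1) \<le> w * card (K - {{}})"
    using diff_card_le_card_Diff[of "{{}}" K] by simp
  also have "\<dots> = (\<Sum>A\<in>K - {{}}. w)" by simp
  also have "\<dots> \<le> (\<Sum>A\<in>K - {{}}. card A)" by (rule sum_mono) (use wt in auto)
  also have "\<dots> \<le> (\<Sum>A\<in>K. card A)" by (rule sum_mono2) (use fK in auto)
  finally show False using up big by simp
qed

text \<open>Each value exceeds \<open>2 * m\<close> by an even amount and the total excess is 2, so
  a single element carries all of it.\<close>

lemma unique_exception_of_sum:
  fixes f :: "'a \<Rightarrow> nat"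
  assumes fin: "finite L" and ge: "\<And>x. x \<in> L \<Longrightarrow> even (f x) \<and> 2 * m \<le> f x"
    and sum: "sum f L = 2 * m * card L + 2"
  shows "\<exists>x\<in>L. f x = 2 * m + 2 \<and> (\<forall>y\<in>L. y \<noteq> x \<longrightarrow> f y = 2 * m)"
proof -
  have "\<exists>x\<in>L. f x \<noteq> 2 * m"
  proof (rule ccontr)
    assume "\<not> ?thesis"
    then have "sum f L = (\<Sum>x\<in>L. 2 * m)" by (intro sum.cong) auto
    then show False using sum by simp
  qed
  then obtain x where x: "x \<in> L" "f x \<noteq> 2 * m" by blast
  have fx: "2 * m + 2 \<le> f x" using ge[OF x(1)] x(2) by presburger
  have split: "sum f L = f x + sum f (L - {x})" using fin x by (simp add: sum.remove)
  have cL: "card L = Suc (card (L - {x}))" using fin x by (metis card_Suc_Diff1)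
  have other: "f y = 2 * m" if y: "y \<in> L" "y \<noteq> x" for y
  proof (rule ccontr)
    assume ne: "f y \<noteq> 2 * m"
    have "f y > 2 * m" using ge[OF y(1)] ne by simp
    then have "(\<Sum>z\<in>L - {x}. 2 * m) < sum f (L - {x})"
      using fin ge y by (intro sum_strict_mono_ex1) auto
    then show False using sum split fx cL by (simp add: algebra_simps)
  qed
  then have "sum f (L - {x}) = (\<Sum>z\<in>L - {x}. 2 * m)" by (intro sum.cong) auto
  then have "f x = 2 * m + 2" using sum split cL by (simp add: algebra_simps)
  then show ?thesis using x other by blast
qed

section \<open>Codes of length 12, dimension 4 and even weights at least 6\<close>

text \<open>For the code of dependencies, the disjointness condition will make \<open>C - D\<close>
  independent, and the word meeting \<open>D\<close> only in \<open>b\<close> will give the five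
  basis elements summing to \<open>b\<close>.\<close>

lemma code_12_4_6_information_set:
  fixes K :: "'a set set"
  assumes C: "finite C" "card C = 12" and K: "K \<subseteq> Pow C" "card K = 16" "sym_diff_closed K"
    and wt: "\<And>A. A \<in> K \<Longrightarrow> A \<noteq> {} \<Longrightarrow> even (card A) \<and> 6 \<le> card A"
  shows "\<exists>D\<subseteq>C. card D = 4 \<and> (\<forall>A\<in>K. A \<inter> D = {} \<longrightarrow> A = {}) \<and>
    (\<forall>b\<in>D. \<exists>A\<in>K. A \<inter> D = {b} \<and> card A = 6)"
proof -
  have fK: "finite K" using K(1) C(1) by (simp add: finite_subset)
  have fin: "finite A" if "A \<in> K" for A using that K(1) C(1) by (auto intro: finite_subset)
  have empty: "{} \<in> K" using K empty_in_sym_diff_closed[OF K(3)] by (metis card.empty ex_in_conv zero_neq_numeral)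
  define L where "L c = {A \<in> K. c \<notin> A}" for c
  have L: "finite (L c)" "sym_diff_closed (L c)" "L c \<subseteq> K" "{} \<in> L c" for c
    using fK sym_diff_closed_avoiding[OF K(3)] empty by (auto simp: L_def)
  \<comment> \<open>The required inequality is 8 * 11 = 88 < 90 = 6 * 15.\<close>
  have K8: "card {A \<in> K. c \<in> A} = 8" if "c \<in> C" for c
    by (rule all_containing_nonzero[OF C(1) fK K(1,3), where w = 6]) (use K C wt that in auto)
  have L8: "card (L c) = 8" if c: "c \<in> C" for c
  proof -
    have "{A \<in> K. c \<in> A} \<noteq> {}" using K8[OF c] by (metis card.empty zero_neq_numeral)
    then show ?thesis using card_avoiding[OF fK K(3)] K(2) by (fastforce simp: L_def)
  qed
  \<comment> \<open>The same argument for the subcode \<open>L c\<close> on 11 points: 4 * 10 = 40 <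
    42 = 6 * 7.\<close>
  have L4: "card {A \<in> L c. d \<in> A} = 4" if cd: "c \<in> C" "d \<in> C" "d \<noteq> c" for c d
  proof (rule all_containing_nonzero[where w = 6 and C = "C - {c}"])
    show "L c \<subseteq> Pow (C - {c})" using K(1) by (auto simp: L_def)
  qed (use L L8 C cd wt in \<open>auto simp: L_def\<close>)
  \<comment> \<open>The total weight of \<open>L c\<close> is 11 * 4 = 44, which is 2 more than 6
    for each of its 7 nonempty words.\<close>
  have exc: "\<exists>F\<in>L c. card F = 8 \<and> (\<forall>A\<in>L c. A \<noteq> {} \<longrightarrow> A \<noteq> F \<longrightarrow> card A = 6)" if c: "c \<in> C" for c
  proof -
    have sub: "L c \<subseteq> Pow (C - {c})" using K(1) by (auto simp: L_def)
    have "(\<Sum>A\<in>L c. card A) = (\<Sum>d\<in>C - {c}. card {A \<in> L c. d \<in> A})"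
      by (rule sum_card_eq_sum_containing[OF _ L(1) sub]) (use C in simp)
    also have "\<dots> = (\<Sum>d\<in>C - {c}. 4)" by (rule sum.cong) (use L4 c in auto)
    also have "\<dots> = 44" using C c by simp
    finally have "(\<Sum>A\<in>L c - {{}}. card A) = 44" using L by (simp add: sum_diff1_nat)
    moreover have "card (L c - {{}}) = 7" using L8[OF c] L by simp
    ultimately have "\<exists>F\<in>L c - {{}}. card F = 2 * 3 + 2 \<and>
        (\<forall>A\<in>L c - {{}}. A \<noteq> F \<longrightarrow> card A = 2 * 3)"
      by (intro unique_exception_of_sum) (use L wt in \<open>auto simp: L_def\<close>)
    then show ?thesis by fastforce
  qed
  obtain b1 where b1: "b1 \<in> C" using C by fastforce
  obtain F where F: "F \<in> K" "b1 \<notin> F" "card F = 8"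
    and F6: "\<And>A. A \<in> K \<Longrightarrow> b1 \<notin> A \<Longrightarrow> A \<noteq> {} \<Longrightarrow> A \<noteq> F \<Longrightarrow> card A = 6"
    using exc[OF b1] unfolding L_def by blast
  have FC: "F \<subseteq> C" using F K by blast
  have "card (C - F) = 4" using F FC C fin by (simp add: card_Diff_subset)
  then have "card (C - F - {b1}) = 3" using b1 F C by simp
  then have "C - F - {b1} \<noteq> {}" by (metis card.empty zero_neq_numeral)
  then obtain b2 where b2: "b2 \<in> C" "b2 \<notin> F" "b2 \<noteq> b1" by blast
  obtain b3 where b3: "b3 \<in> F" using F by fastforce
  have b3': "b3 \<in> C" "b3 \<noteq> b1" "b3 \<noteq> b2" using b3 FC F b2 by auto
  obtain F' where F': "F' \<in> K" "b3 \<notin> F'" "card F' = 8"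
    and F'6: "\<And>A. A \<in> K \<Longrightarrow> b3 \<notin> A \<Longrightarrow> A \<noteq> {} \<Longrightarrow> A \<noteq> F' \<Longrightarrow> card A = 6"
    using exc[OF b3'(1)] unfolding L_def by blast
  \<comment> \<open>A point outside both would be avoided by two words of size 8, distinct because
    only \<open>F\<close> contains \<open>b3\<close>.\<close>
  have cover: "x \<in> F \<or> x \<in> F'" if x: "x \<in> C" for x
  proof (rule ccontr)
    assume "\<not> ?thesis"
    then have "F \<in> L x" "F' \<in> L x" using F F' by (auto simp: L_def)
    moreover have "F \<noteq> F'" "F \<noteq> {}" "F' \<noteq> {}" using b3 F F' by auto
    moreover obtain H where H: "\<And>A. A \<in> L x \<Longrightarrow> A \<noteq> {} \<Longrightarrow> A \<noteq> H \<Longrightarrow> card A = 6"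
      using exc[OF x] by blast
    ultimately have "F = H" "F' = H" using H[of F] H[of F'] F(3) F'(3) by auto
    then show False using b3 F'(2) by blast
  qed
  \<comment> \<open>The nesting allows \<open>card_avoiding\<close> to be applied twice, halving 8
    to 4 and then to 2. The second time \<open>F\<close> is the word containing the excluded
    point.\<close>
  define M where "M = {A \<in> {A \<in> L b1. b2 \<notin> A}. b3 \<notin> A}"
  have M: "card M = 2"
  proof -
    have "{A \<in> L b1. b2 \<in> A} \<noteq> {}" using L4[OF b1 b2(1,3)] by (metis card.empty zero_neq_numeral)
    then have "card (L b1) = 2 * card {A \<in> L b1. b2 \<notin> A}"
      using card_avoiding[OF L(1,2)] by fast
    moreover have "card {A \<in> L b1. b2 \<notin> A} = 2 * card M" unfolding M_def
    proof (rule card_avoiding[where A = F])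
      show "finite {A \<in> L b1. b2 \<notin> A}" using L(1) by simp
      show "sym_diff_closed {A \<in> L b1. b2 \<notin> A}" by (rule sym_diff_closed_avoiding[OF L(2)])
    qed (use b3 F b2 in \<open>auto simp: L_def\<close>)
    ultimately show ?thesis using L8[OF b1] by simp
  qed
  have "{} \<in> M" using empty by (simp add: M_def L_def)
  moreover obtain X Y where "M = {X, Y}" "X \<noteq> Y" using M by (auto simp: card_2_iff)
  ultimately obtain G where G: "M = {{}, G}" "G \<noteq> {}"
    by (cases "X = {}") (auto simp: insert_commute)
  have "G \<in> M" using G(1) by simp
  then have GM: "G \<in> K" "b1 \<notin> G" "b2 \<notin> G" "b3 \<notin> G" by (simp_all add: M_def L_def)
  have G6: "card G = 6" using F6 GM G(2) b3 by blast
  have "\<not> G \<subseteq> F'"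
  proof
    assume sub: "G \<subseteq> F'"
    have "sym_diff F' G = F' - G" using sub by blast
    then have "F' - G \<in> K" using sym_diff_closedD[OF K(3) F'(1) GM(1)] by simp
    moreover have "card (F' - G) = 2" using sub F'(3) G6 fin[OF GM(1)] by (simp add: card_Diff_subset)
    ultimately show False using wt[of "F' - G"] by fastforce
  qed
  then obtain b4 where b4: "b4 \<in> G" "b4 \<notin> F'" by blast
  have b4': "b4 \<in> C" "b4 \<noteq> b1" "b4 \<noteq> b2" "b4 \<noteq> b3" using b4 GM K(1) by auto
  define D where "D = {b1, b2, b3, b4}"
  have D: "D \<subseteq> C" "card D = 4" using b1 b2 b3' b4' by (auto simp: D_def)
  have ker: "A = {}" if "A \<in> K" "A \<inter> D = {}" for A
  proof -
    have "A \<in> M" "b4 \<notin> A" using that by (auto simp: M_def L_def D_def)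
    then show ?thesis using G b4 by auto
  qed
  have inj: "inj_on (\<lambda>A. A \<inter> D) K"
  proof (rule inj_onI)
    fix A B assume AB: "A \<in> K" "B \<in> K" "A \<inter> D = B \<inter> D"
    then have "sym_diff A B = {}" using ker[OF sym_diff_closedD[OF K(3)]] by blast
    then show "A = B" by blast
  qed
  \<comment> \<open>Injectivity suffices, since \<open>K\<close> and \<open>Pow D\<close> both have
    16 elements.\<close>
  have onto: "(\<lambda>A. A \<inter> D) ` K = Pow D"
    by (rule card_subset_eq) (use card_image[OF inj] K(2) D C(1) in \<open>auto simp: card_Pow finite_subset\<close>)
  have surj: "\<exists>A\<in>K. A \<inter> D = {b}" if "b \<in> D" for b
  proof -
    have "{b} \<in> (\<lambda>A. A \<inter> D) ` K" unfolding onto using that by simp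
    then show ?thesis by (metis (no_types, lifting) imageE)
  qed
  have "\<exists>A\<in>K. A \<inter> D = {b} \<and> card A = 6" if b: "b \<in> D" for b
  proof -
    obtain A where A: "A \<in> K" "A \<inter> D = {b}" using surj[OF b] by blast
    have ne: "A \<noteq> {}" using A by auto
    have FF': "b1 \<in> F'" "b2 \<in> F'" "b3 \<in> F" "b4 \<in> F"
      using cover[OF b1] cover[OF b2(1)] cover[OF b4'(1)] b2(2) b3 b4(2) F(2) by simp_all
    have mem: "x \<in> A \<longleftrightarrow> x = b" if "x \<in> D" for x using A(2) that by blast
    have mem': "b1 \<in> A \<longleftrightarrow> b1 = b" "b2 \<in> A \<longleftrightarrow> b2 = b" "b3 \<in> A \<longleftrightarrow> b3 = b" "b4 \<in> A \<longleftrightarrow> b4 = b"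
      by (rule mem, simp add: D_def)+
    have "card A = 6"
    \<comment> \<open>In the first case \<open>A\<close> avoids \<open>b3\<close> and differs from
      \<open>F'\<close>, which contains both \<open>b1\<close> and \<open>b2\<close>. Otherwise
      \<open>A\<close> avoids \<open>b1\<close> and differs from \<open>F\<close>, which contains
      both \<open>b3\<close> and \<open>b4\<close>.\<close>
    proof (cases "b = b1 \<or> b = b2")
      case True
      then have "b3 \<notin> A" "\<not> (b1 \<in> A \<and> b2 \<in> A)" using mem' b3'(2,3) b2(3) by blast+
      then show ?thesis using F'6 A(1) ne FF' by blast
    next
      case False
      then have "b1 \<notin> A" "\<not> (b3 \<in> A \<and> b4 \<in> A)" using mem' b4'(4) by blast+
      then show ?thesis using F6 A(1) ne FF' by blast
    qed
    then show ?thesis using A by blast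
  qed
  then show ?thesis using D ker by blast
qed

section \<open>Subset sums and subspaces over the two-element field\<close>

text \<open>This makes \<open>bit ^ 'n\<close> a finite type, so the rule \<open>finite\<close>
  settles finiteness of all its subsets.\<close>

instance bit :: finite
proof
  have "(UNIV :: bit set) = {0, 1}" by auto
  then show "finite (UNIV :: bit set)" by (metis finite.emptyI finite_insert)
qed

lemma bit_vec_add_self [simp]: "x + x = (0 :: bit ^ 'n)"
  by (simp add: vec_eq_iff)

lemma bit_vec_minus [simp]: "- x = (x :: bit ^ 'n)" "x - y = (x + y :: bit ^ 'n)"
  by (simp_all add: vec_eq_iff)

text \<open>The terms over \<open>A \<inter> B\<close> occur twice on the right and cancel.\<close>

lemma sum_sym_diff_char2:
  fixes f :: "'a \<Rightarrow> 'b::ab_group_add"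
  assumes "finite A" "finite B" and two: "\<And>x::'b. x + x = 0"
  shows "sum f (sym_diff A B) = sum f A + sum f B"
proof -
  have "sum f (sym_diff A B) = sum f (A - B) + sum f (B - A)"
    by (rule sum.union_disjoint) (use assms in auto)
  moreover have "sum f A = sum f (A \<inter> B) + sum f (A - B)" "sum f B = sum f (A \<inter> B) + sum f (B - A)"
    using sum.Int_Diff[of A f B] sum.Int_Diff[of B f A] assms by (simp_all add: Int_commute)
  ultimately have "sum f A + sum f B = (sum f (A \<inter> B) + sum f (A \<inter> B)) + sum f (sym_diff A B)"
    by (simp only: ac_simps)
  then show ?thesis using two by simp
qed

lemma Sum_sym_diff:
  fixes A B :: "(bit ^ 'n) set"
  shows "\<Sum>(sym_diff A B) = \<Sum>A + \<Sum>B"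
  by (rule sum_sym_diff_char2) simp_all

lemma even_card_sym_diff:
  assumes "finite A" "finite B"
  shows "even (card (sym_diff A B)) \<longleftrightarrow> (even (card A) \<longleftrightarrow> even (card B))"
proof -
  have "card A = card (A \<inter> B) + card (A - B)" "card B = card (A \<inter> B) + card (B - A)"
    using card_Int_Diff[of A B] card_Int_Diff[of B A] assms by (simp_all add: Int_commute)
  moreover have "card (sym_diff A B) = card (A - B) + card (B - A)"
    by (rule card_Un_disjoint) (use assms in auto)
  ultimately show ?thesis by auto
qed

text \<open>Coefficients are 0 or 1, so linear combinations of \<open>T\<close> are its subset sums;
  independence makes distinct subsets have distinct sums.\<close>

lemma card_span_independent_bit:
  fixes T :: "(bit ^ 'n) set"
  assumes "vec.independent T"
  shows "card (vec.span T) = 2 ^ card T"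
proof -
  have indep: "A = {}" if "A \<subseteq> T" "\<Sum>A = 0" for A
  proof (rule ccontr)
    assume "A \<noteq> {}"
    then obtain v where v: "v \<in> A" by blast
    have "(\<Sum>u\<in>A. 1 *s u) = 0" using that(2) by simp
    then have "(1::bit) = 0"
      using assms[unfolded vec.independent_explicit_module, rule_format, OF finite that(1) _ v, of "\<lambda>_. 1"]
      by simp
    then show False by simp
  qed
  have inj: "inj_on Sum (Pow T)"
  proof (rule inj_onI)
    fix A B assume AB: "A \<in> Pow T" "B \<in> Pow T" "\<Sum>A = \<Sum>B"
    then have "\<Sum>(sym_diff A B) = 0" by (simp add: Sum_sym_diff)
    then have "sym_diff A B = {}" using AB by (intro indep) auto
    then show "A = B" by blast
  qed
  have "vec.span T = Sum ` Pow T"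
  proof
    show "vec.span T \<subseteq> Sum ` Pow T"
    proof
      fix x assume "x \<in> vec.span T"
      then obtain u where u: "x = (\<Sum>v\<in>T. u v *s v)"
        unfolding vec.span_finite[OF finite] by blast
      have "u v *s v = (if u v = 1 then v else 0)" for v by (cases "u v") simp_all
      then have "x = \<Sum>{v \<in> T. u v = 1}" unfolding u by (simp add: sum.inter_filter)
      then show "x \<in> Sum ` Pow T" by blast
    qed
    show "Sum ` Pow T \<subseteq> vec.span T"
      by (auto intro!: vec.span_sum intro: vec.span_base)
  qed
  then show ?thesis using card_image[OF inj] by (simp add: card_Pow)
qed

lemma card_subspace_bit:
  fixes V :: "(bit ^ 'n) set"
  assumes "vec.subspace V"
  shows "card V = 2 ^ vec.dim V"
proof -
  obtain T where T: "T \<subseteq> V" "vec.independent T" "V \<subseteq> vec.span T" "card T = vec.dim V"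
    using vec.basis_exists by blast
  have "vec.span T = V" using vec.span_subspace[OF T(1,3) assms] .
  then show ?thesis using card_span_independent_bit[OF T(2)] T(4) by simp
qed

section \<open>Affine hulls and the code of dependencies\<close>

lemma affI:
  fixes S :: "(bit ^ 'n) set"
  assumes "A \<subseteq> S" "odd (card A)" "\<Sum>A = x"
  shows "x \<in> aff S"
  unfolding aff_def mem_Collect_eq by (rule exI[of _ A]) (simp add: assms)

text \<open>The symmetric difference of two odd sets is even; conversely, toggling a point
  \<open>c\<close> turns an even set into an odd one. For empty \<open>C\<close> the left side would
  be empty and the right side \<open>{0}\<close>.\<close>

lemma direction_aff:
  fixes C :: "(bit ^ 'n) set"
  assumes "C \<noteq> {}"
  shows "{x - y | x y. x \<in> aff C \<and> y \<in> aff C} = Sum ` {A. A \<subseteq> C \<and> even (card A)}"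
proof (intro set_eqI iffI)
  fix z assume "z \<in> {x - y | x y. x \<in> aff C \<and> y \<in> aff C}"
  then obtain A B where "A \<subseteq> C" "B \<subseteq> C" "odd (card A)" "odd (card B)" "z = \<Sum>A + \<Sum>B"
    by (auto simp: aff_def)
  then have "z = \<Sum>(sym_diff A B)" "sym_diff A B \<in> {A. A \<subseteq> C \<and> even (card A)}"
    by (auto simp only: Sum_sym_diff even_card_sym_diff[OF finite finite])
  then show "z \<in> Sum ` {A. A \<subseteq> C \<and> even (card A)}" by blast
next
  fix z assume "z \<in> Sum ` {A. A \<subseteq> C \<and> even (card A)}"
  then obtain A where A: "A \<subseteq> C" "even (card A)" "z = \<Sum>A" by blast
  obtain c where c: "c \<in> C" using assms by blast
  have "\<Sum>{c} \<in> aff C" by (rule affI[of "{c}"]) (simp_all add: c)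
  moreover have "\<Sum>(sym_diff A {c}) \<in> aff C"
  proof -
    have "sym_diff A {c} \<subseteq> C" using A c by blast
    moreover have "odd (card (sym_diff A {c}))"
      using A by (simp only: even_card_sym_diff[OF finite finite]) simp
    ultimately show ?thesis by (rule affI) simp
  qed
  moreover have "z = \<Sum>(sym_diff A {c}) - \<Sum>{c}"
    by (simp only: Sum_sym_diff A(3)) (simp add: add.assoc)
  ultimately show "z \<in> {x - y | x y. x \<in> aff C \<and> y \<in> aff C}" by blast
qed

text \<open>This is the code \<open>K\<close>, with the points of \<open>C\<close> as coordinates.
  Even size makes the dependencies affine rather than merely linear.\<close>

definition dependencies :: "(bit ^ 'n) set \<Rightarrow> (bit ^ 'n) set set" where
  "dependencies C = {A. A \<subseteq> C \<and> even (card A) \<and> \<Sum>A = 0}"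

lemma sym_diff_closed_even:
  assumes "finite C"
  shows "sym_diff_closed {A. A \<subseteq> C \<and> even (card A)}"
  unfolding sym_diff_closed_def
proof (intro ballI)
  fix A B assume "A \<in> {A. A \<subseteq> C \<and> even (card A)}" "B \<in> {A. A \<subseteq> C \<and> even (card A)}"
  then show "sym_diff A B \<in> {A. A \<subseteq> C \<and> even (card A)}"
    using assms even_card_sym_diff[of A B] by (auto dest: finite_subset)
qed

lemma sym_diff_closed_dependencies: "sym_diff_closed (dependencies C)"
proof -
  have "dependencies C = {A \<in> {A. A \<subseteq> C \<and> even (card A)}. \<Sum>A = 0}"
    by (auto simp: dependencies_def)
  then show ?thesis
    using sym_diff_closed_even[of C, OF finite] unfolding sym_diff_closed_def
    by (simp only: mem_Collect_eq Sum_sym_diff) simp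
qed

lemma card_even_subsets:
  assumes "finite C" "C \<noteq> {}"
  shows "2 * card {A. A \<subseteq> C \<and> even (card A)} = 2 ^ card C"
proof -
  let ?h = "\<lambda>A. of_bool (odd (card A)) :: bit"
  obtain c where c: "c \<in> C" using assms by blast
  have cl: "sym_diff_closed (Pow C)" by (auto simp: sym_diff_closed_def)
  have "card (Pow C) = card (?h ` Pow C) * card {A \<in> Pow C. ?h A = 0}"
  proof (rule card_image_mult_card_kernel[OF _ cl])
    fix A B assume "A \<in> Pow C" "B \<in> Pow C"
    then have "finite A" "finite B" using assms(1) by (auto intro: finite_subset)
    then show "?h (sym_diff A B) = ?h A + ?h B" by (simp only: even_card_sym_diff) auto
  qed (use assms in simp)
  moreover have "?h ` Pow C = {0, 1}"
  proof
    have "0 = ?h {}" "1 = ?h {c}" by simp_all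
    then show "{0, 1} \<subseteq> ?h ` Pow C" using c by blast
  qed auto
  moreover have "{A \<in> Pow C. ?h A = 0} = {A. A \<subseteq> C \<and> even (card A)}" by auto
  ultimately show ?thesis using assms by (simp add: card_Pow)
qed

text \<open>Rank-nullity in multiplicative form: \<open>Sum\<close> maps the even subsets onto the
  direction space with kernel \<open>dependencies C\<close>. The \<open>+ 1\<close> accounts for
  only half of all subsets being even.\<close>

lemma card_dependencies:
  fixes C :: "(bit ^ 'n) set"
  assumes "C \<noteq> {}"
  shows "2 ^ (aff_dimension C + 1) * card (dependencies C) = 2 ^ card C"
proof -
  let ?E = "{A. A \<subseteq> C \<and> even (card A)}"
  have cl: "sym_diff_closed ?E" by (rule sym_diff_closed_even) simp
  have "vec.subspace (Sum ` ?E)"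
  proof (rule vec.subspaceI)
    have "\<Sum>{} \<in> Sum ` ?E" by (rule imageI) simp
    then show zero: "0 \<in> Sum ` ?E" by simp
    show "x + y \<in> Sum ` ?E" if xy: "x \<in> Sum ` ?E" "y \<in> Sum ` ?E" for x y
    proof -
      obtain A B where AB: "A \<in> ?E" "B \<in> ?E" "x = \<Sum>A" "y = \<Sum>B" using xy by blast
      then have "x + y = \<Sum>(sym_diff A B)" by (simp only: Sum_sym_diff)
      then show ?thesis using sym_diff_closedD[OF cl AB(1,2)] by (simp only: imageI)
    qed
    show "k *s x \<in> Sum ` ?E" if "x \<in> Sum ` ?E" for k x
      using that zero by (cases k) (simp_all only: vector_smult_lzero vector_smult_lid)
  qed
  then have "card (Sum ` ?E) = 2 ^ aff_dimension C"
    unfolding aff_dimension_def flat_dim_def direction_aff[OF assms] by (rule card_subspace_bit)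
  moreover have "card ?E = card (Sum ` ?E) * card {A \<in> ?E. \<Sum>A = 0}"
    by (rule card_image_mult_card_kernel[OF _ cl]) (simp_all only: Sum_sym_diff finite)
  moreover have "{A \<in> ?E. \<Sum>A = 0} = dependencies C" by (auto simp: dependencies_def)
  ultimately show ?thesis using card_even_subsets[OF finite assms] by simp
qed

text \<open>Size 2 would force two distinct points to be equal, and size 4 would give a
  quad.\<close>

lemma dependencies_of_cap:
  assumes "cap C" "A \<in> dependencies C" "A \<noteq> {}"
  shows "even (card A) \<and> 6 \<le> card A"
proof -
  have A: "A \<subseteq> C" "even (card A)" "\<Sum>A = 0" using assms by (auto simp: dependencies_def)
  have "card A \<noteq> 0" using assms by simp
  moreover have "card A \<noteq> 4" using assms A by (auto simp: cap_def quad_def)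
  moreover have "card A \<noteq> 2"
  proof
    assume "card A = 2"
    then obtain x y where "A = {x, y}" "x \<noteq> y" by (auto simp: card_2_iff)
    then show False using A(3) by (simp add: add_eq_0_iff)
  qed
  ultimately show ?thesis using A(2) by presburger
qed

section \<open>Affine independence and bases\<close>

lemma aff_aff_subset: "aff S \<subseteq> aff B" if "S \<subseteq> aff B" for S B :: "(bit ^ 'n) set"
proof
  fix x assume "x \<in> aff S"
  then obtain A where A: "A \<subseteq> S" "odd (card A)" "x = \<Sum>A" by (auto simp: aff_def)
  \<comment> \<open>Each summand is replaced by an odd subset of \<open>B\<close>, merged in by
    symmetric difference. The parity of \<open>A\<close> is tracked because it alternates during the
    induction.\<close>
  have "\<exists>A'\<subseteq>B. (odd (card A') \<longleftrightarrow> odd (card A)) \<and> \<Sum>A' = \<Sum>A"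
    using finite[of A] A(1)
  proof (induction A rule: finite_induct)
    case (insert y A)
    then obtain A' where A': "A' \<subseteq> B" "odd (card A') \<longleftrightarrow> odd (card A)" "\<Sum>A' = \<Sum>A" by auto
    obtain Y where Y: "Y \<subseteq> B" "odd (card Y)" "y = \<Sum>Y"
      using insert.prems \<open>S \<subseteq> aff B\<close> by (auto simp: aff_def)
    have "sym_diff Y A' \<subseteq> B" using A' Y by blast
    moreover have "odd (card (sym_diff Y A')) \<longleftrightarrow> odd (card (insert y A))"
      using A' Y insert.hyps by (simp add: even_card_sym_diff)
    moreover have "\<Sum>(sym_diff Y A') = \<Sum>(insert y A)"
      using A' Y insert.hyps by (simp add: Sum_sym_diff)
    ultimately show ?case by blast
  qed auto
  then show "x \<in> aff B" using A(2,3) affI by metis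
qed

text \<open>Removing a point from a nonempty dependency leaves an odd set summing to that point;
  adjoining the point reverses this.\<close>

lemma aff_independent_iff_dependencies:
  "aff_independent B \<longleftrightarrow> dependencies B = {{}}"
proof
  assume ind: "aff_independent B"
  have "A = {}" if "A \<in> dependencies B" for A
  proof (rule ccontr)
    assume "A \<noteq> {}"
    then obtain x where x: "x \<in> A" by blast
    have A: "A \<subseteq> B" "even (card A)" "\<Sum>A = 0" using that by (auto simp: dependencies_def)
    have "\<Sum>(A - {x}) = x" using x A(3) by (simp add: sum_diff1)
    moreover have "odd (card (A - {x}))" using A(2) card.remove[OF finite x] by (metis even_Suc)
    moreover have "A - {x} \<subseteq> B - {x}" using A(1) by blast
    ultimately have "x \<in> aff (B - {x})" by (intro affI)
    then show False using ind A(1) x by (auto simp: aff_independent_def)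
  qed
  then show "dependencies B = {{}}" by (auto simp: dependencies_def)
next
  assume dep: "dependencies B = {{}}"
  show "aff_independent B"
    unfolding aff_independent_def
  proof (intro ballI notI)
    fix x assume x: "x \<in> B" "x \<in> aff (B - {x})"
    then obtain A where A: "A \<subseteq> B - {x}" "odd (card A)" "x = \<Sum>A" by (auto simp: aff_def)
    then have "x \<notin> A" by blast
    then have "insert x A \<in> dependencies B" using A x(1) by (auto simp: dependencies_def)
    then show False unfolding dep by simp
  qed
qed

text \<open>Two odd representations of \<open>x\<close> differ by a dependency of \<open>B\<close>,
  which must be empty.\<close>

lemma basis_part_eqI:
  assumes ind: "aff_independent B" and A: "A \<subseteq> B" "odd (card A)" "\<Sum>A = x"
  shows "basis_part B x = A"
  unfolding basis_part_def
proof (rule the_equality)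
  fix A' assume A': "A' \<subseteq> B \<and> finite A' \<and> odd (card A') \<and> \<Sum>A' = x"
  then have "sym_diff A' A \<in> dependencies B"
    using A unfolding dependencies_def by (auto simp only: Sum_sym_diff even_card_sym_diff[OF finite finite] bit_vec_add_self)
  then have "sym_diff A' A = {}" using ind by (simp only: aff_independent_iff_dependencies singleton_iff)
  then show "A' = A" by blast
qed (use A in simp)

theorem theorem7p1:
  fixes C :: "(bit ^ 'n) set"
  assumes "k_cap 12 C"
    and "aff_dimension C = 7"
  shows "\<exists>B. aff_basis C B \<and> basis_type C B = [5, 5, 5, 5]"
proof -
  have C: "cap C" "card C = 12" using assms(1) by (auto simp: k_cap_def)
  then have "C \<noteq> {}" by auto
  \<comment> \<open>Here 2^(7 + 1) * 16 = 2^12.\<close>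
  then have K16: "card (dependencies C) = 16"
    using card_dependencies[of C] assms(2) C(2) by simp
  have sub: "dependencies C \<subseteq> Pow C" by (auto simp: dependencies_def)
  have "\<exists>D\<subseteq>C. card D = 4 \<and> (\<forall>A\<in>dependencies C. A \<inter> D = {} \<longrightarrow> A = {}) \<and>
      (\<forall>b\<in>D. \<exists>A\<in>dependencies C. A \<inter> D = {b} \<and> card A = 6)"
    by (rule code_12_4_6_information_set[OF finite C(2) sub K16 sym_diff_closed_dependencies])
      (rule dependencies_of_cap[OF C(1)])
  then obtain D where D: "D \<subseteq> C" "card D = 4"
    and ker: "\<forall>A\<in>dependencies C. A \<inter> D = {} \<longrightarrow> A = {}"
    and dual: "\<forall>b\<in>D. \<exists>A\<in>dependencies C. A \<inter> D = {b} \<and> card A = 6"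
    by (elim exE conjE)
  define B where "B = C - D"
  \<comment> \<open>Deleting \<open>b\<close> from its word of size 6 leaves five points, all
    outside \<open>D\<close>, whose sum is \<open>b\<close> since the whole word sums to 0.\<close>
  have part: "\<exists>A\<subseteq>B. card A = 5 \<and> \<Sum>A = b" if b: "b \<in> D" for b
  proof -
    obtain A where A: "A \<in> dependencies C" "A \<inter> D = {b}" "card A = 6" using dual b by blast
    have "b \<in> A" using A(2) by blast
    moreover have "A \<subseteq> C" "\<Sum>A = 0" using A(1) by (simp_all add: dependencies_def)
    ultimately have "A - {b} \<subseteq> B" "card (A - {b}) = 5" "\<Sum>(A - {b}) = b"
      using A(2,3) by (auto simp only: B_def) (simp_all add: sum_diff1)
    then show ?thesis by blast
  qed
  \<comment> \<open>A dependency within \<open>B\<close> is a word disjoint from \<open>D\<close>,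
    hence empty.\<close>
  have ind: "aff_independent B"
  proof -
    have "A = {}" if "A \<in> dependencies B" for A
    proof (rule ker[rule_format])
      show "A \<in> dependencies C" "A \<inter> D = {}" using that by (auto simp: dependencies_def B_def)
    qed
    then show ?thesis unfolding aff_independent_iff_dependencies by (auto simp: dependencies_def)
  qed
  have "C \<subseteq> aff B"
  proof
    fix x assume x: "x \<in> C"
    have "\<exists>A\<subseteq>B. odd (card A) \<and> \<Sum>A = x"
    proof (cases "x \<in> D")
      case True
      then obtain A where "A \<subseteq> B" "card A = 5" "\<Sum>A = x" using part by blast
      then show ?thesis by (intro exI[of _ A]) simp
    next
      case False
      then show ?thesis using x by (intro exI[of _ "{x}"]) (simp add: B_def)
    qed
    then show "x \<in> aff B" using affI by blast
  qed
  then have "aff C \<subseteq> aff B" by (rule aff_aff_subset)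
  moreover have "aff B \<subseteq> aff C" by (auto simp: aff_def B_def)
  ultimately have basis: "aff_basis C B" using ind by (auto simp: aff_basis_def B_def)
  have part5: "card (basis_part B b) = 5" if b: "b \<in> D" for b
  proof -
    obtain A where A: "A \<subseteq> B" "card A = 5" "\<Sum>A = b" using part[OF b] by blast
    then have "basis_part B b = A" by (intro basis_part_eqI[OF ind]) simp_all
    then show ?thesis using A by simp
  qed
  have "C - B = D" using D by (auto simp: B_def)
  then have "image_mset (\<lambda>x. card (basis_part B x)) (mset_set (C - B)) = image_mset (\<lambda>_. 5) (mset_set D)"
    by (simp only:) (rule image_mset_cong, simp add: part5)
  then have "image_mset (\<lambda>x. card (basis_part B x)) (mset_set (C - B)) = replicate_mset 4 5"
    using D(2) by (simp add: image_mset_const_eq)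
  then have "basis_type C B = [5, 5, 5, 5]"
    unfolding basis_type_def by (simp add: numeral_eq_Suc)
  then show ?thesis using basis by blast
qed

end
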